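(* Let $C_1,\ldots,C_4$ be four non-overlapping closed convex sets in $\mathbb{R}^2$ bounded by closed convex curves $\gamma_1,\ldots,\gamma_4$ around the vertices of a convex quadrilateral $A_1A_2A_3A_4$, with associated region $\Omega$ (see context), let $P$ be a given point inside $\Omega$, and let $A_i'$ be the orthogonal projection of $P$ onto $\gamma_i$. Assume that $A_1'A_2'A_3'A_4'$ is a convex quadrilateral and that $P$ lies in the interior of $\triangle A_1'A_2'A_3'\cap\triangle A_1'A_2'A_4'$ and in the exterior of $\triangle A_1'A_3'A_4'$. Then the dynamic plasticity of $C_1,\ldots,C_4$, i.e. the set of positive weights $((w_1)_{1\ldots4},\ldots,(w_4)_{1\ldots4})$ solving the inverse generalized Fermat-Torricelli problem for $P$, is given by the following three equations: $$\Big(\frac{w_2}{w_1}\Big)_{1\ldots4}=\Big(\frac{w_2}{w_1}\Big)_{123}\Big[1-\Big(\frac{w_4}{w_1}\Big)_{1\ldots4}\Big(\frac{w_1}{w_4}\Big)_{134}\Big],$$ $$\Big(\frac{w_3}{w_1}\Big)_{1\ldots4}=\Big(\frac{w_3}{w_1}\Big)_{123}\Big[1-\Big(\frac{w_4}{w_1}\Big)_{1\ldots4}\Big(\frac{w_1}{w_4}\Big)_{124}\Big],$$ $$\sum_{i=1}^4 (w_i)_{1\ldots4}=\mathrm{const}.$$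
   Context: Setting: $A_1A_2A_3A_4$ is a convex quadrilateral in $\mathbb{R}^2$. For each $i$, $\gamma_i$ is a closed convex curve surrounding $A_i$ that meets orthogonally the two sides of the quadrilateral containing $A_i$; the curves do not intersect each other inside the quadrilateral. Segments on the edges and four arcs of the $\gamma_i$ bound a curvilinear octagon $\Omega$. $d$ is Euclidean distance. Generalized Fermat-Torricelli (F-T) point: for positive weights $w_i$, the point minimizing $\sum_i w_i\,d(P,\gamma_i)$. Inverse generalized F-T problem: given a point $P$ inside $\Omega$, find positive weights $w_i$, with $\sum_i w_i$ equal to a prescribed constant (normalized as $1$), for which $P$ is the generalized F-T point. Dynamic plasticity is the set of all solutions of this inverse problem, the weights being written $(w_i)_{1\ldots4}$. $\big(\frac{w_i}{w_j}\big)_{1\ldots 4}$ denotes $(w_i)_{1\ldots4}/(w_j)_{1\ldots4}$. Triangle ratios: $(w_j)_{jkl}$ denotes the weight at $A_j'$ in the inverse problem with the same point $P$ for the triangle $\triangle A_j'A_k'A_l'$ (a negative ratio being used for $\triangle A_1'A_3'A_4'$, which does not contain $P$). Explicitly, with all angles in $(0,\pi)$, $$\Big(\frac{w_2}{w_1}\Big)_{123}=\frac{\sin\angle A_1'PA_3'}{\sin\angle A_2'PA_3'},\quad \Big(\frac{w_3}{w_1}\Big)_{123}=\frac{\sin\angle A_1'PA_2'}{\sin\angle A_2'PA_3'},\quad \Big(\frac{w_1}{w_4}\Big)_{124}=\frac{\sin\angle A_2'PA_4'}{\sin\angle A_1'PA_2'},\quad \Big(\frac{w_1}{w_4}\Big)_{134}=-\frac{\sin\angle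 A_3'PA_4'}{\sin\angle A_1'PA_3'}.$$ *)

theory Defs
  imports "HOL-Analysis.Analysis"
begin

text \<open>
  The four vertices, curves and weights are indexed by the numeral type \<^typ>\<open>4\<close>, whose elements are
  1, 2, 3 and 4 = 0. Its addition is cyclic, so \<open>A (i + 1)\<close> and \<open>A (i - 1)\<close> are the neighbours of \<open>A i\<close>.
\<close>

text \<open>
  For every side, the two other vertices lie strictly on one side of the line through it. This rules
  out three collinear vertices and orderings of the vertices in which sides cross.
\<close>

definition convex_quadrilateral :: "(4 \<Rightarrow> real^2) \<Rightarrow> bool" where
  "convex_quadrilateral A \<longleftrightarrow>
     (\<forall>i. \<exists>n b. n \<bullet> A i = b \<and> n \<bullet> A (i + 1) = b \<and> n \<bullet> A (i + 2) < b \<and> n \<bullet> A (i + 3) < b)"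

definition region_bounded_by :: "(real^2) set \<Rightarrow> (real^2) set" where
  "region_bounded_by \<gamma> = \<gamma> \<union> inside \<gamma>"

definition closed_convex_curve :: "(real^2) set \<Rightarrow> bool" where
  "closed_convex_curve \<gamma> \<longleftrightarrow>
     (\<exists>g. simple_path g \<and> pathfinish g = pathstart g \<and> path_image g = \<gamma>) \<and>
     convex (region_bounded_by \<gamma>)"

text \<open>
  The limit says that the directions of the secants of \<open>\<gamma>\<close> through \<open>x\<close> become perpendicular to
  \<open>b - a\<close>, i.e. that the line through \<open>x\<close> perpendicular to the segment is the tangent of \<open>\<gamma>\<close> at \<open>x\<close>.
\<close>

definition meets_orthogonally :: "(real^2) set \<Rightarrow> real^2 \<Rightarrow> real^2 \<Rightarrow> bool" where
  "meets_orthogonally \<gamma> a b \<longleftrightarrow>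
     \<gamma> \<inter> closed_segment a b \<noteq> {} \<and>
     (\<forall>x \<in> \<gamma> \<inter> closed_segment a b.
        ((\<lambda>y. ((y - x) \<bullet> (b - a)) / norm (y - x)) \<longlongrightarrow> 0) (at x within \<gamma>))"

text \<open>
  The octagon without its four arcs; only its interior points are used, so this makes no difference.
\<close>

definition curvilinear_octagon :: "(4 \<Rightarrow> real^2) \<Rightarrow> (4 \<Rightarrow> (real^2) set) \<Rightarrow> (real^2) set" where
  "curvilinear_octagon A \<gamma> = convex hull (range A) - (\<Union>i. region_bounded_by (\<gamma> i))"

text \<open>
  Minimality over the whole plane, not assumed strict: if the curves contain line segments, the
  minimizer need not be unique.
\<close>

definition generalized_FT_point :: "(4 \<Rightarrow> real) \<Rightarrow> (4 \<Rightarrow> (real^2) set) \<Rightarrow> real^2 \<Rightarrow> bool" where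
  "generalized_FT_point w \<gamma> P \<longleftrightarrow>
     (\<forall>Q. (\<Sum>i\<in>UNIV. w i * infdist P (\<gamma> i)) \<le> (\<Sum>i\<in>UNIV. w i * infdist Q (\<gamma> i)))"

definition dynamic_plasticity :: "real \<Rightarrow> (4 \<Rightarrow> (real^2) set) \<Rightarrow> real^2 \<Rightarrow> (4 \<Rightarrow> real) set" where
  "dynamic_plasticity c \<gamma> P =
     {w. (\<forall>i. 0 < w i) \<and> (\<Sum>i\<in>UNIV. w i) = c \<and> generalized_FT_point w \<gamma> P}"

definition angle :: "real^2 \<Rightarrow> real^2 \<Rightarrow> real^2 \<Rightarrow> real" where
  "angle X P Y = arccos (((X - P) \<bullet> (Y - P)) / (norm (X - P) * norm (Y - P)))"

text \<open>
  The ratio of the weight at \<open>X\<close> to the weight at \<open>Y\<close> for which \<open>P\<close> is the Fermat-Torricelli point of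
  the triangle \<open>X Y Z\<close> (law of sines for three balanced forces), when \<open>P\<close> is inside the triangle.
  When \<open>P\<close> lies beyond the side \<open>X Z\<close>, balance needs weights of opposite signs at \<open>X\<close> and \<open>Y\<close>, and the
  ratio is then taken with a minus sign.
\<close>

definition triangle_ratio :: "real^2 \<Rightarrow> real^2 \<Rightarrow> real^2 \<Rightarrow> real^2 \<Rightarrow> real" where
  "triangle_ratio P X Y Z = sin (angle Y P Z) / sin (angle X P Z)"

end

theory Submission
  imports Defs
begin

text \<open>
  Let \<open>a\<^sub>i = A'\<^sub>i - P\<close>. The distance to \<open>\<gamma>\<^sub>i\<close> is bounded above by the distance to the point \<open>A'\<^sub>i\<close> and
  below by the signed distance to the supporting line of the convex region at \<open>A'\<^sub>i\<close>, with equality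
  at \<open>P\<close> in both cases. Hence \<open>P\<close> is a generalized Fermat-Torricelli point iff the weighted unit
  vectors \<open>a\<^sub>i / |a\<^sub>i|\<close> sum to \<open>0\<close>. Since \<open>a\<^sub>2\<close> and \<open>a\<^sub>3\<close> are independent, this is equivalent to the
  vanishing of the cross products of the sum with \<open>a\<^sub>3\<close> and \<open>a\<^sub>2\<close>, which are the two ratio equations
  once the signs of the cross products \<open>a\<^sub>i \<times> a\<^sub>j\<close> are known.
\<close>

section \<open>The balance condition\<close>

text \<open>Necessity differentiates the upper bound, which is smooth at \<open>P\<close> because
  \<open>a i \<noteq> P\<close>. Sufficiency sums the lower bounds, which are affine in
  \<open>Q\<close> and whose linear parts cancel under balance.\<close>

lemma weighted_infdist_min_iff:
  fixes S :: "'i::finite \<Rightarrow> 'a::euclidean_space set"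
  assumes w: "\<And>i. 0 \<le> w i"
    and aS: "\<And>i. a i \<in> S i"
    and ne: "\<And>i. a i \<noteq> P"
    and supp: "\<And>i y. y \<in> S i \<Longrightarrow> (P - a i) \<bullet> (y - a i) \<le> 0"
  shows "(\<forall>Q. (\<Sum>i\<in>UNIV. w i * infdist P (S i)) \<le> (\<Sum>i\<in>UNIV. w i * infdist Q (S i)))
    \<longleftrightarrow> (\<Sum>i\<in>UNIV. (w i / norm (a i - P)) *\<^sub>R (a i - P)) = 0"
proof -
  \<comment> \<open>\<open>u i\<close> is both the unit normal of the supporting line at
    \<open>a i\<close> and the gradient at \<open>P\<close> of the distance to
    \<open>a i\<close>.\<close>
  define u where "u i = (P - a i) /\<^sub>R norm (P - a i)" for i
  have norm_u: "norm (u i) = 1" for i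
    using ne[of i] by (simp add: u_def)
  have u_supp: "u i \<bullet> (y - a i) \<le> 0" if "y \<in> S i" for i y
    using supp[OF that] by (simp add: u_def mult_nonneg_nonpos)
  have lower: "u i \<bullet> (Q - a i) \<le> infdist Q (S i)" for i Q
  proof -
    have "u i \<bullet> (Q - a i) \<le> dist Q y" if "y \<in> S i" for y
    proof -
      have "u i \<bullet> (Q - a i) = u i \<bullet> (Q - y) + u i \<bullet> (y - a i)"
        by (simp add: inner_diff_right)
      also have "\<dots> \<le> u i \<bullet> (Q - y)"
        using u_supp[OF that] by simp
      also have "\<dots> \<le> norm (u i) * norm (Q - y)"
        by (rule norm_cauchy_schwarz)
      finally show ?thesis by (simp add: norm_u dist_norm)
    qed
    then show ?thesis
      using aS[of i] by (auto simp: infdist_def intro!: cINF_greatest)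
  qed
  have u_P: "u i \<bullet> (P - a i) = norm (P - a i)" for i
    using ne[of i] by (simp add: u_def dot_square_norm power2_eq_square)
  have at_P: "infdist P (S i) = norm (P - a i)" for i
    using lower[of i P] infdist_le[OF aS, of P i] u_P[of i] by (simp add: dist_norm)
  have sum_u: "(\<Sum>i\<in>UNIV. (w i / norm (a i - P)) *\<^sub>R (a i - P)) = - (\<Sum>i\<in>UNIV. w i *\<^sub>R u i)"
  proof -
    have "(w i / norm (a i - P)) *\<^sub>R (a i - P) = - (w i *\<^sub>R u i)" for i
      by (simp add: u_def norm_minus_commute divide_inverse algebra_simps)
    then show ?thesis
      by (simp add: sum_negf)
  qed
  show ?thesis
  proof
    assume min: "\<forall>Q. (\<Sum>i\<in>UNIV. w i * infdist P (S i)) \<le> (\<Sum>i\<in>UNIV. w i * infdist Q (S i))"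
    \<comment> \<open>\<open>g\<close> dominates the weighted sum of distances and agrees with it at
      \<open>P\<close>, so it inherits the minimum there.\<close>
    define g where "g Q = (\<Sum>i\<in>UNIV. w i * norm (Q - a i))" for Q
    have g_min: "g P \<le> g Q" for Q
    proof -
      have "g P \<le> (\<Sum>i\<in>UNIV. w i * infdist Q (S i))"
        using min by (simp add: g_def at_P)
      also have "\<dots> \<le> g Q"
        unfolding g_def dist_norm[symmetric]
        by (intro sum_mono mult_left_mono infdist_le aS w)
      finally show ?thesis .
    qed
    have "((\<lambda>Q. norm (Q - a i)) has_derivative (\<lambda>h. u i \<bullet> h)) (at P)" for i
    proof -
      have "((\<lambda>Q. norm (Q - a i)) has_derivative (\<lambda>h. h \<bullet> sgn (P - a i))) (at P)"
        using ne[of i]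
        by (intro has_derivative_compose[OF _ has_derivative_norm, of "\<lambda>Q. Q - a i" "\<lambda>h. h"])
          (auto intro!: derivative_eq_intros)
      then show ?thesis
        by (simp add: u_def sgn_div_norm inner_commute)
    qed
    then have "(g has_derivative (\<lambda>h. \<Sum>i\<in>UNIV. w i * (u i \<bullet> h))) (at P)"
      unfolding g_def by (auto intro!: derivative_intros)
    then have "(\<lambda>h. \<Sum>i\<in>UNIV. w i * (u i \<bullet> h)) = (\<lambda>h. 0)"
      by (rule differential_zero_maxmin[rotated 2, of _ _ _ UNIV]) (use g_min in auto)
    then have "(\<Sum>i\<in>UNIV. w i *\<^sub>R u i) \<bullet> h = 0" for h
      by (simp add: inner_sum_left fun_eq_iff)
    then show "(\<Sum>i\<in>UNIV. (w i / norm (a i - P)) *\<^sub>R (a i - P)) = 0"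
      unfolding sum_u using inner_eq_zero_iff by fastforce
  next
    assume "(\<Sum>i\<in>UNIV. (w i / norm (a i - P)) *\<^sub>R (a i - P)) = 0"
    then have bal: "(\<Sum>i\<in>UNIV. w i *\<^sub>R u i) = 0"
      by (simp add: sum_u)
    show "\<forall>Q. (\<Sum>i\<in>UNIV. w i * infdist P (S i)) \<le> (\<Sum>i\<in>UNIV. w i * infdist Q (S i))"
    proof
      fix Q
      have "(\<Sum>i\<in>UNIV. w i * infdist P (S i)) = (\<Sum>i\<in>UNIV. w i * (u i \<bullet> (P - a i)))"
        by (simp add: at_P u_P)
      \<comment> \<open>Moving from \<open>P\<close> to \<open>Q\<close> changes the affine bounds
        only by a multiple of the balance sum, which vanishes by \<open>bal\<close>.\<close>
      also have "\<dots> = (\<Sum>i\<in>UNIV. w i * (u i \<bullet> (Q - a i))) + (\<Sum>i\<in>UNIV. w i *\<^sub>R u i) \<bullet> (P - Q)"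
        by (simp add: inner_sum_left inner_diff_right algebra_simps flip: sum.distrib)
      also have "\<dots> \<le> (\<Sum>i\<in>UNIV. w i * infdist Q (S i))"
        using bal by (auto intro!: sum_mono mult_left_mono lower w)
      finally show "(\<Sum>i\<in>UNIV. w i * infdist P (S i)) \<le> (\<Sum>i\<in>UNIV. w i * infdist Q (S i))" .
    qed
  qed
qed

section \<open>Nearest points on a closed convex curve\<close>

lemma closed_convex_curve_compact: "closed_convex_curve \<gamma> \<Longrightarrow> compact \<gamma>"
  unfolding closed_convex_curve_def using compact_simple_path_image by blast

text \<open>The curve is not a convex set, so the projection inequality is applied to its region. As
  \<open>P\<close> lies outside, the nearest point of the region is on the curve, hence a nearest
  point of the curve is also nearest in the region.\<close>

lemma closest_point_curve_supporting:
  assumes curve: "closed_convex_curve \<gamma>"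
    and ne: "\<gamma> \<noteq> {}"
    and P: "P \<notin> region_bounded_by \<gamma>"
    and y: "y \<in> \<gamma>"
  shows "(P - closest_point \<gamma> P) \<bullet> (y - closest_point \<gamma> P) \<le> 0"
proof -
  let ?C = "region_bounded_by \<gamma>" and ?a = "closest_point \<gamma> P"
  have cl: "closed \<gamma>"
    using closed_convex_curve_compact[OF curve] by (rule compact_imp_closed)
  have clC: "closed ?C"
    using cl by (simp add: region_bounded_by_def union_with_inside closed_Compl open_outside)
  have sub: "\<gamma> \<subseteq> ?C"
    by (simp add: region_bounded_by_def)
  have neC: "?C \<noteq> {}"
    using ne sub by blast
  have "inside \<gamma> \<subseteq> interior ?C"
    by (rule interior_maximal) (auto simp: region_bounded_by_def open_inside cl)
  moreover have "closest_point ?C P \<notin> interior ?C"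
  proof
    assume int: "closest_point ?C P \<in> interior ?C"
    \<comment> \<open>A nonempty interior makes the affine hull the whole plane, so the criterion
      for relative interiors applies to \<open>P\<close>.\<close>
    then have "rel_interior ?C = interior ?C" "affine hull ?C = UNIV"
      using rel_interior_nonempty_interior affine_hull_nonempty_interior by blast+
    then show False
      using int P closest_point_in_rel_interior[OF clC neC, of P] interior_subset by auto
  qed
  ultimately have c\<gamma>: "closest_point ?C P \<in> \<gamma>"
    using closest_point_in_set[OF clC neC, of P] by (auto simp: region_bounded_by_def)
  have "dist P ?a \<le> dist P z" if "z \<in> ?C" for z
    using closest_point_le[OF cl c\<gamma>, of P] closest_point_le[OF clC that, of P] by linarith
  then show ?thesis
    using curve clC closest_point_in_set[OF cl ne] sub y
    by (intro any_closest_point_dot[of ?C]) (auto simp: closed_convex_curve_def)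
qed

section \<open>Signed areas\<close>

definition cross2 :: "real^2 \<Rightarrow> real^2 \<Rightarrow> real" where
  "cross2 x y = x $ 1 * y $ 2 - x $ 2 * y $ 1"

lemma cross2_commute: "cross2 y x = - cross2 x y"
  by (simp add: cross2_def)

lemma cross2_add: "cross2 (x + y) z = cross2 x z + cross2 y z"
  by (simp add: cross2_def algebra_simps)

lemma cross2_scaleR: "cross2 (r *\<^sub>R x) y = r * cross2 x y"
  by (simp add: cross2_def algebra_simps)

lemma cross2_self [simp]: "cross2 x x = 0"
  by (simp add: cross2_def)

lemma cross2_zero [simp]: "cross2 0 x = 0"
  by (simp add: cross2_def)

text \<open>Cramer's rule: the linear relation between three plane vectors, with signed areas as
  coefficients.\<close>

lemma cross2_dependency:
  "cross2 b c *\<^sub>R a + cross2 c a *\<^sub>R b + cross2 a b *\<^sub>R c = 0"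
  by (simp add: cross2_def vec_eq_iff forall_2 algebra_simps)

lemma cross2_inner_dependency:
  "cross2 b c * (n \<bullet> a) + cross2 c a * (n \<bullet> b) + cross2 a b * (n \<bullet> c) = 0"
  using arg_cong[OF cross2_dependency[of b c a], of "inner n"]
  by (simp add: inner_add_right)

lemma eq_zero_if_cross2_eq_zero:
  assumes "cross2 b c \<noteq> 0" "cross2 v b = 0" "cross2 v c = 0"
  shows "v = 0"
  using cross2_dependency[of b c v] assms cross2_commute[of c v] by simp

text \<open>Lagrange's identity in the plane; it turns cosines into sines and a vanishing area into
  equality in Cauchy-Schwarz.\<close>

lemma inner_cross2: "(x \<bullet> y)\<^sup>2 + (cross2 x y)\<^sup>2 = (norm x)\<^sup>2 * (norm y)\<^sup>2"
  unfolding power2_norm_eq_inner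
  by (simp add: cross2_def inner_vec_def sum_2 power2_eq_square algebra_simps)

lemma collinear_if_cross2_eq_zero:
  assumes "cross2 x y = 0"
  shows "collinear {0, x, y}"
proof -
  have "\<bar>x \<bullet> y\<bar> = norm x * norm y"
    by (rule power2_eq_imp_eq) (use inner_cross2[of x y] assms in \<open>simp_all add: power_mult_distrib\<close>)
  then show ?thesis
    by (simp add: norm_cauchy_schwarz_equal)
qed

text \<open>The range of \<open>arccos\<close> makes the sine nonnegative. The sign of the area is
  thereby lost and must be recovered from the position of \<open>P\<close>.\<close>

lemma sin_angle:
  assumes "X \<noteq> P" "Y \<noteq> P"
  shows "sin (angle X P Y) = \<bar>cross2 (X - P) (Y - P)\<bar> / (norm (X - P) * norm (Y - P))"
proof -
  let ?x = "X - P" and ?y = "Y - P"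
  let ?N = "norm ?x * norm ?y"
  have N: "?N > 0"
    using assms by simp
  have bound: "\<bar>?x \<bullet> ?y / ?N\<bar> \<le> 1"
    using N Cauchy_Schwarz_ineq2[of ?x ?y] by (simp add: field_simps)
  then have "-1 \<le> ?x \<bullet> ?y / ?N" "?x \<bullet> ?y / ?N \<le> 1"
    by linarith+
  then have "sin (angle X P Y) = sqrt (1 - (?x \<bullet> ?y / ?N)\<^sup>2)"
    unfolding angle_def by (rule sin_arccos)
  also have "1 - (?x \<bullet> ?y / ?N)\<^sup>2 = (cross2 ?x ?y / ?N)\<^sup>2"
  proof -
    have "1 - (p / r)\<^sup>2 = (q / r)\<^sup>2" if "p\<^sup>2 + q\<^sup>2 = r\<^sup>2" "0 < r" for p q r :: real
      using that by (simp add: power_divide field_simps)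
    then show ?thesis
      using N inner_cross2[of ?x ?y] by (simp add: power_mult_distrib)
  qed
  also have "sqrt \<dots> = \<bar>cross2 ?x ?y\<bar> / ?N"
    using N by (simp only: real_sqrt_abs) simp
  finally show ?thesis .
qed

lemma triangle_ratio_cross2:
  assumes "X \<noteq> P" "Y \<noteq> P" "Z \<noteq> P"
  shows "triangle_ratio P X Y Z =
    (\<bar>cross2 (Y - P) (Z - P)\<bar> * norm (X - P)) / (\<bar>cross2 (X - P) (Z - P)\<bar> * norm (Y - P))"
  using assms unfolding triangle_ratio_def by (simp add: sin_angle)

section \<open>Signs forced by the position of \<open>P\<close>\<close>

text \<open>The three signed areas seen from \<open>P\<close> are proportional to its barycentric
  coordinates, which are positive in the interior. Their common sign \<open>s\<close> is the
  orientation of the triangle.\<close>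

lemma interior_triangle_cross2:
  fixes a b c P :: "real^2"
  assumes P: "P \<in> interior (convex hull {a, b, c})"
  obtains s where "\<bar>s\<bar> = 1" "0 < s * cross2 (a - P) (b - P)" "0 < s * cross2 (b - P) (c - P)"
    "0 < s * cross2 (c - P) (a - P)"
proof -
  have ncol: "\<not> collinear {a, b, c}"
  proof -
    have "aff_dim (convex hull {a, b, c}) = DIM(real^2)"
      using P by (intro aff_dim_nonempty_interior) auto
    then show ?thesis
      by (simp add: collinear_aff_dim aff_dim_convex_hull)
  qed
  then obtain x y z where pos: "0 < x" "0 < y" "0 < z" and 1: "x + y + z = 1"
    and "x *\<^sub>R a + y *\<^sub>R b + z *\<^sub>R c = P"
    using P by (auto simp: interior_convex_hull_3_minimal)
  moreover have "x *\<^sub>R P + y *\<^sub>R P + z *\<^sub>R P = P"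
    using 1 by (simp flip: scaleR_left_distrib)
  ultimately have "x *\<^sub>R (a - P) + y *\<^sub>R (b - P) + z *\<^sub>R (c - P) = 0"
    by (simp add: algebra_simps)
  then have "cross2 (x *\<^sub>R (a - P) + y *\<^sub>R (b - P) + z *\<^sub>R (c - P)) v = 0" for v
    by simp
  then have lin: "x * cross2 (a - P) v + y * cross2 (b - P) v + z * cross2 (c - P) v = 0" for v
    by (simp add: cross2_add cross2_scaleR)
  define t where "t = cross2 (a - P) (b - P)"
  have bc: "cross2 (b - P) (c - P) = x / z * t"
    using lin[of "b - P"] pos cross2_commute[of "c - P" "b - P"] by (simp add: t_def field_simps)
  have ca: "cross2 (c - P) (a - P) = y / z * t"
    using lin[of "a - P"] pos cross2_commute[of "b - P" "a - P"] by (simp add: t_def field_simps)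
  \<comment> \<open>The three areas add up to that of the whole triangle, so \<open>t = 0\<close>
    would make it degenerate.\<close>
  have "t \<noteq> 0"
  proof
    assume "t = 0"
    then have "cross2 (a - c) (b - c) = 0"
      using bc ca by (simp add: t_def cross2_def algebra_simps)
    then have "collinear {0, a - c, b - c}"
      by (rule collinear_if_cross2_eq_zero)
    then have "collinear {a, c, b}"
      by (subst collinear_3) (simp_all add: NO_MATCH_def)
    then show False
      using ncol by (simp add: insert_commute)
  qed
  then show thesis
    using pos by (intro that[of "sgn t"]) (auto simp: bc ca t_def[symmetric] sgn_if mult_pos_neg)
qed

text \<open>
  That \<open>0\<close> is inside the triangles 123 and 124 leaves the order of the directions of \<open>a3\<close> and \<open>a4\<close>
  open; it is the convex position of the four points that excludes the order 1, 2, 4, 3.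
\<close>

lemma convex_position_cross2:
  fixes a1 a2 a3 a4 :: "real^2"
  assumes s: "0 < s * cross2 a1 a2" "0 < s * cross2 a2 a3" "0 < s * cross2 a3 a1"
    and n: "n \<bullet> a2 = h" "n \<bullet> a3 = h" "n \<bullet> a1 < h" "n \<bullet> a4 < h"
    and m: "m \<bullet> a3 = k" "m \<bullet> a4 = k" "m \<bullet> a1 < k" "m \<bullet> a2 < k"
  shows "0 \<le> s * cross2 a3 a4"
proof (rule ccontr)
  assume "\<not> ?thesis"
  then have neg: "s * cross2 a3 a4 < 0" by simp
  \<comment> \<open>Up to the factor \<open>s\<close>, these are twice the signed areas of
    \<open>a1 a2 a3\<close> and \<open>a2 a3 a4\<close>. First \<open>h\<close> and \<open>k\<close>
    are shown positive, so that the origin is on the inner side of both lines; then the two lines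
    give contradictory signs for \<open>?U\<close>.\<close>
  let ?T = "s * cross2 a1 a2 + s * cross2 a2 a3 + s * cross2 a3 a1"
  let ?U = "s * cross2 a2 a3 + s * cross2 a3 a4 + s * cross2 a4 a2"
  have dep: "s * cross2 b c * (v \<bullet> a) + s * cross2 c a * (v \<bullet> b) + s * cross2 a b * (v \<bullet> c) = 0"
    for a b c v
    using arg_cong[OF cross2_inner_dependency[of b c v a], of "(*) s"] by (simp add: algebra_simps)
  have T: "?T > 0" using s by linarith
  have "s * cross2 a2 a3 * (n \<bullet> a1) < s * cross2 a2 a3 * h"
    using s n by (intro mult_strict_left_mono)
  then have "0 < ?T * h"
    using dep[of a2 a3 n a1] n by (simp add: algebra_simps)
  then have h: "0 < h" using T by (rule zero_less_mult_pos)
  have "s * cross2 a2 a3 * (m \<bullet> a1) < s * cross2 a2 a3 * k"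
    "s * cross2 a3 a1 * (m \<bullet> a2) < s * cross2 a3 a1 * k"
    using mult_strict_left_mono[OF m(3) s(2)] mult_strict_left_mono[OF m(4) s(3)] .
  then have "0 < ?T * k"
    using dep[of a2 a3 m a1] m by (simp add: algebra_simps)
  then have k: "0 < k" using T by (rule zero_less_mult_pos)
  have "s * cross2 a2 a3 * (n \<bullet> a4) < s * cross2 a2 a3 * h"
    using s n by (intro mult_strict_left_mono)
  then have "0 < ?U * h"
    using dep[of a2 a3 n a4] n by (simp add: algebra_simps)
  then have U: "0 < ?U" using h by (rule zero_less_mult_pos2)
  \<comment> \<open>The origin and \<open>a2\<close> lie on the same side of the line through
    \<open>a3\<close> and \<open>a4\<close>, so \<open>?U\<close> takes the negative sign of
    \<open>s * cross2 a3 a4\<close>.\<close>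
  have "s * cross2 a3 a4 * (m \<bullet> a2) > s * cross2 a3 a4 * k"
    using neg m by (intro mult_strict_left_mono_neg)
  then have "?U * k < 0"
    using dep[of a3 a4 m a2] m by (simp add: algebra_simps)
  then show False
    using U k mult_pos_pos[of ?U k] by linarith
qed

section \<open>From balance to weight ratios\<close>

text \<open>Crossing with \<open>a 3\<close> eliminates \<open>w 3\<close> and yields the first
  equation; crossing with \<open>a 2\<close> eliminates \<open>w 2\<close> and yields the second.
  The sign hypotheses remove the absolute values.\<close>

lemma balance_iff_ratios:
  fixes a :: "4 \<Rightarrow> real^2"
  assumes s: "\<bar>s\<bar> = 1" "0 < s * cross2 (a 1) (a 2)" "0 < s * cross2 (a 2) (a 3)"
      "0 < s * cross2 (a 3) (a 1)" "0 < s * cross2 (a 2) (a 4)" "0 \<le> s * cross2 (a 3) (a 4)"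
    and w: "0 < w 1"
    and a: "\<And>i. a i \<noteq> 0"
  shows "(\<Sum>i\<in>UNIV. (w i / norm (a i)) *\<^sub>R a i) = 0 \<longleftrightarrow>
    w 2 / w 1 = (\<bar>cross2 (a 1) (a 3)\<bar> * norm (a 2)) / (\<bar>cross2 (a 2) (a 3)\<bar> * norm (a 1)) *
      (1 - w 4 / w 1 * (- ((\<bar>cross2 (a 4) (a 3)\<bar> * norm (a 1)) / (\<bar>cross2 (a 1) (a 3)\<bar> * norm (a 4))))) \<and>
    w 3 / w 1 = (\<bar>cross2 (a 1) (a 2)\<bar> * norm (a 3)) / (\<bar>cross2 (a 3) (a 2)\<bar> * norm (a 1)) *
      (1 - w 4 / w 1 * ((\<bar>cross2 (a 4) (a 2)\<bar> * norm (a 1)) / (\<bar>cross2 (a 1) (a 2)\<bar> * norm (a 4))))"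
    (is "?v = 0 \<longleftrightarrow> ?E2 \<and> ?E3")
proof -
  \<comment> \<open>Absorbing the norms makes balance a linear relation among the
    \<open>a i\<close>; \<open>t\<close> measures areas relative to the orientation
    \<open>s\<close>.\<close>
  define W where "W i = w i / norm (a i)" for i
  define t where "t i j = s * cross2 (a i) (a j)" for i j
  have abs_t: "\<bar>cross2 (a i) (a j)\<bar> = t i j" if "0 \<le> t i j" for i j
    using abs_of_nonneg[OF that] s(1) by (simp add: t_def abs_mult)
  have t_commute: "t j i = - t i j" for i j
    by (simp add: t_def cross2_commute[of "a j" "a i"])
  have pos: "0 < t 1 2" "0 < t 2 3" "0 < t 3 1" "0 < t 2 4" "0 \<le> t 3 4"
    using s by (simp_all add: t_def)
  have abs_eq: "\<bar>cross2 (a 1) (a 3)\<bar> = t 3 1" "\<bar>cross2 (a 2) (a 3)\<bar> = t 2 3" "\<bar>cross2 (a 4) (a 3)\<bar> = t 3 4"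
    "\<bar>cross2 (a 1) (a 2)\<bar> = t 1 2" "\<bar>cross2 (a 3) (a 2)\<bar> = t 2 3" "\<bar>cross2 (a 4) (a 2)\<bar> = t 2 4"
    using abs_t[of 3 1] abs_t[of 2 3] abs_t[of 3 4] abs_t[of 1 2] abs_t[of 2 4] pos
    by (simp_all add: cross2_commute[of "a 1" "a 3"] cross2_commute[of "a 4" "a 3"]
        cross2_commute[of "a 3" "a 2"] cross2_commute[of "a 4" "a 2"])
  have w_eq: "w i = W i * norm (a i)" for i
    using a by (simp add: W_def)
  have N: "0 < norm (a i)" for i
    using a by simp
  have W1: "0 < W 1" using w N by (simp add: W_def)
  \<comment> \<open>Both equations have this shape once the norms cancel. \<open>r\<close> may be
    negative: \<open>- t 3 4\<close> absorbs the minus sign of the ratio for the triangle 134, while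
    the other equation takes \<open>r\<close> to be \<open>t 2 4\<close>.\<close>
  have ratio: "W i * N\<^sub>i / (W 1 * N\<^sub>1) = p * N\<^sub>i / (t 2 3 * N\<^sub>1) * (1 - W 4 * N\<^sub>4 / (W 1 * N\<^sub>1) * (r * N\<^sub>1 / (p * N\<^sub>4)))
      \<longleftrightarrow> W i * t 2 3 = W 1 * p - W 4 * r"
    if "0 < N\<^sub>i" "0 < N\<^sub>1" "0 < N\<^sub>4" "0 < p" for i N\<^sub>i N\<^sub>1 N\<^sub>4 p r
  proof -
    have "1 - W 4 * N\<^sub>4 / (W 1 * N\<^sub>1) * (r * N\<^sub>1 / (p * N\<^sub>4)) = (W 1 * p - W 4 * r) / (W 1 * p)"
      using that W1 by (simp add: field_simps)
    then have "p * N\<^sub>i / (t 2 3 * N\<^sub>1) * (1 - W 4 * N\<^sub>4 / (W 1 * N\<^sub>1) * (r * N\<^sub>1 / (p * N\<^sub>4)))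
        = N\<^sub>i / (W 1 * N\<^sub>1) * ((W 1 * p - W 4 * r) / t 2 3)"
      using that by simp
    moreover have "W i * N\<^sub>i / (W 1 * N\<^sub>1) = N\<^sub>i / (W 1 * N\<^sub>1) * W i"
      by simp
    moreover have "N\<^sub>i / (W 1 * N\<^sub>1) \<noteq> 0"
      using that W1 by simp
    ultimately show ?thesis
      using pos(2) by (simp only: mult_cancel_left) (simp add: eq_divide_eq)
  qed
  have E2: "?E2 \<longleftrightarrow> W 2 * t 2 3 = W 1 * t 3 1 + W 4 * t 3 4"
    unfolding abs_eq w_eq
    using ratio[OF N N N pos(3), where i = 2 and r = "- t 3 4"] by simp
  have E3: "?E3 \<longleftrightarrow> W 3 * t 2 3 = W 1 * t 1 2 - W 4 * t 2 4"
    unfolding abs_eq w_eq by (rule ratio[OF N N N pos(1)])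
  have cross_v: "s * cross2 ?v (a j) = W 1 * t 1 j + W 2 * t 2 j + W 3 * t 3 j + W 4 * t 4 j" for j
    by (simp add: sum_4 cross2_add cross2_scaleR t_def W_def algebra_simps)
  have "s \<noteq> 0" "cross2 (a 2) (a 3) \<noteq> 0"
    using s by auto
  then have "?v = 0 \<longleftrightarrow> s * cross2 ?v (a 2) = 0 \<and> s * cross2 ?v (a 3) = 0"
    using eq_zero_if_cross2_eq_zero[of "a 2" "a 3" ?v] by auto
  also have "\<dots> \<longleftrightarrow> ?E2 \<and> ?E3"
  proof -
    have "t 2 2 = 0" "t 3 3 = 0" by (simp_all add: t_def)
    then show ?thesis
      unfolding E2 E3 cross_v t_commute[of 3 2] t_commute[of 4 2] t_commute[of 1 3] t_commute[of 4 3]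
      by auto
  qed
  finally show ?thesis .
qed

theorem theorem3:
  fixes A A' :: "4 \<Rightarrow> real^2"
    and \<gamma> :: "4 \<Rightarrow> (real^2) set"
    and P :: "real^2"
    and c :: real
  assumes "convex_quadrilateral A"
    and "\<And>i. closed_convex_curve (\<gamma> i)"
    and "\<And>i. A i \<in> inside (\<gamma> i)"
    and "\<And>i. meets_orthogonally (\<gamma> i) (A i) (A (i + 1))"
    and "\<And>i. meets_orthogonally (\<gamma> i) (A i) (A (i - 1))"
    and "\<And>i. \<gamma> i \<inter> closed_segment (A (i + 1)) (A (i + 2)) = {}"
    and "\<And>i. \<gamma> i \<inter> closed_segment (A (i + 2)) (A (i + 3)) = {}"
    and "\<And>i j. i \<noteq> j \<Longrightarrow> \<gamma> i \<inter> \<gamma> j \<inter> convex hull (range A) = {}"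
    and "\<And>i j. i \<noteq> j \<Longrightarrow> interior (region_bounded_by (\<gamma> i)) \<inter> interior (region_bounded_by (\<gamma> j)) = {}"
    and "P \<in> interior (curvilinear_octagon A \<gamma>)"
    and "\<And>i. A' i = closest_point (\<gamma> i) P"
    and "convex_quadrilateral A'"
    and "P \<in> interior (convex hull {A' 1, A' 2, A' 3} \<inter> convex hull {A' 1, A' 2, A' 4})"
    and "P \<notin> convex hull {A' 1, A' 3, A' 4}"
  shows "dynamic_plasticity c \<gamma> P =
    {w. (\<forall>i. 0 < w i) \<and>
        w 2 / w 1 = triangle_ratio P (A' 2) (A' 1) (A' 3) *
                      (1 - w 4 / w 1 * (- triangle_ratio P (A' 1) (A' 4) (A' 3))) \<and>
        w 3 / w 1 = triangle_ratio P (A' 3) (A' 1) (A' 2) *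
                      (1 - w 4 / w 1 * triangle_ratio P (A' 1) (A' 4) (A' 2)) \<and>
        (\<Sum>i\<in>UNIV. w i) = c}"
proof -
  note curve = assms(2) and oct = assms(10) and A' = assms(11)
    and quad = assms(12)
  define a where "a i = A' i - P" for i
  have P_out: "P \<notin> region_bounded_by (\<gamma> i)" for i
    using subsetD[OF interior_subset oct] by (auto simp: curvilinear_octagon_def)
  have ne: "\<gamma> i \<noteq> {}" for i
    using curve[of i] by (auto simp: closed_convex_curve_def)
  have A'_in: "A' i \<in> \<gamma> i" for i
    unfolding A' by (intro closest_point_in_set compact_imp_closed closed_convex_curve_compact curve ne)
  then have A'_ne: "A' i \<noteq> P" for i
    using P_out[of i] by (auto simp: region_bounded_by_def)
  have FT: "generalized_FT_point w \<gamma> P \<longleftrightarrow> (\<Sum>i\<in>UNIV. (w i / norm (a i)) *\<^sub>R a i) = 0"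
    if "\<And>i. 0 < w i" for w
    unfolding generalized_FT_point_def a_def
    using that A'_in A'_ne P_out ne
    by (intro weighted_infdist_min_iff) (auto simp: less_imp_le A' intro!: closest_point_curve_supporting curve)
  have P_int: "P \<in> interior (convex hull {A' 1, A' 2, A' 3})"
    "P \<in> interior (convex hull {A' 1, A' 2, A' 4})"
    using assms(13) by (simp_all add: interior_Int)
  obtain s where s: "\<bar>s\<bar> = 1" "0 < s * cross2 (a 1) (a 2)" "0 < s * cross2 (a 2) (a 3)"
      "0 < s * cross2 (a 3) (a 1)"
    unfolding a_def using interior_triangle_cross2[OF P_int(1)] by blast
  obtain s' where s': "\<bar>s'\<bar> = 1" "0 < s' * cross2 (a 1) (a 2)" "0 < s' * cross2 (a 2) (a 4)"
    unfolding a_def using interior_triangle_cross2[OF P_int(2)] by blast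
  \<comment> \<open>Both triangles contain the side from \<open>A' 1\<close> to \<open>A' 2\<close>,
    so each sign is that of \<open>cross2 (a 1) (a 2)\<close>.\<close>
  have "s' = s"
    using s s' by (auto simp: abs_if zero_less_mult_iff split: if_splits)
  then have s24: "0 < s * cross2 (a 2) (a 4)"
    using s' by simp
  \<comment> \<open>Indices are cyclic modulo 4; only the sides starting at \<open>A' 2\<close> and
    \<open>A' 3\<close> are required.\<close>
  have index: "(2::4) + 1 = 3" "(2::4) + 2 = 4" "(2::4) + 3 = 1"
    "(3::4) + 1 = 4" "(3::4) + 2 = 1" "(3::4) + 3 = 2"
    by simp_all
  obtain n b where n: "n \<bullet> A' 2 = b" "n \<bullet> A' 3 = b" "n \<bullet> A' 4 < b" "n \<bullet> A' 1 < b"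
    using quad[unfolded convex_quadrilateral_def, rule_format, of 2] by (auto simp only: index)
  obtain m d where m: "m \<bullet> A' 3 = d" "m \<bullet> A' 4 = d" "m \<bullet> A' 1 < d" "m \<bullet> A' 2 < d"
    using quad[unfolded convex_quadrilateral_def, rule_format, of 3] by (auto simp only: index)
  \<comment> \<open>Taking \<open>P\<close> as origin shifts the offsets \<open>b\<close> and
    \<open>d\<close> of the two side lines by \<open>n \<bullet> P\<close> and
    \<open>m \<bullet> P\<close>.\<close>
  have s34: "0 \<le> s * cross2 (a 3) (a 4)"
    by (rule convex_position_cross2[OF s(2-4), of n "b - n \<bullet> P" _ m "d - m \<bullet> P"])
      (use n m in \<open>simp_all add: a_def inner_diff_right\<close>)
  have a_ne: "a i \<noteq> 0" for i
    using A'_ne by (simp add: a_def)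
  have "w \<in> dynamic_plasticity c \<gamma> P \<longleftrightarrow>
        (\<forall>i. 0 < w i) \<and>
        w 2 / w 1 = triangle_ratio P (A' 2) (A' 1) (A' 3) *
                      (1 - w 4 / w 1 * (- triangle_ratio P (A' 1) (A' 4) (A' 3))) \<and>
        w 3 / w 1 = triangle_ratio P (A' 3) (A' 1) (A' 2) *
                      (1 - w 4 / w 1 * triangle_ratio P (A' 1) (A' 4) (A' 2)) \<and>
        (\<Sum>i\<in>UNIV. w i) = c" for w
  proof (cases "\<forall>i. 0 < w i")
    case True
    then show ?thesis
      unfolding dynamic_plasticity_def triangle_ratio_cross2[OF A'_ne A'_ne A'_ne]
      using FT[of w] balance_iff_ratios[OF s s24 s34 _ a_ne, of w]
      by (auto simp only: mem_Collect_eq a_def)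
  next
    case False
    then show ?thesis
      unfolding dynamic_plasticity_def mem_Collect_eq by blast
  qed
  then show ?thesis
    by blast
qed

end
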